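(* (a) For $\ell\in\{4,5\}$ and every positive integer $n$, $$\mathrm{ex}(n,\overrightarrow{C}_3,\overrightarrow{C}_\ell)=\left\lceil\frac{n}{3}\right\rceil\left\lceil\frac{n-1}{3}\right\rceil\left\lceil\frac{n-2}{3}\right\rceil.$$ (b) For every integer $\ell>6$ not divisible by $3$, $\mathrm{ex}(n,\overrightarrow{C}_3,\overrightarrow{C}_\ell)=\frac{n^3}{27}+O(n^2)$.
   Context: An oriented graph is a directed graph without loops in which every pair of vertices is joined by at most one arc. $\overrightarrow{C}_m$ denotes the directed cycle of length $m$. A copy of $H$ in $G$ is a (not necessarily induced) subgraph of $G$ isomorphic to $H$. $\mathrm{ex}(n,\overrightarrow{C}_k,\overrightarrow{C}_\ell)$ is the maximum number of copies of $\overrightarrow{C}_k$ in an $n$-vertex oriented graph containing no copy of $\overrightarrow{C}_\ell$. Asymptotics are as $n\to\infty$ with $\ell$ fixed. *)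

theory Defs
  imports Complex_Main "HOL-Library.Landau_Symbols" "Graph_Theory.Graph_Theory"
begin

locale oriented_graph = pair_digraph +
  assumes no_opposite_arcs: "(u, v) \<in> parcs G \<Longrightarrow> (v, u) \<notin> parcs G"

definition dicycle :: "nat \<Rightarrow> nat pair_pre_digraph" where
  "dicycle m = \<lparr>pverts = {..<m}, parcs = {(i, Suc i mod m) | i. i < m}\<rparr>"

definition copies :: "'a pair_pre_digraph \<Rightarrow> 'b pair_pre_digraph \<Rightarrow> 'b pair_pre_digraph set" where
  "copies H G = {K. subgraph (with_proj K) (with_proj G) \<and> digraph_iso (with_proj K) (with_proj H)}"

text \<open>Every finite oriented graph is isomorphic to one whose vertices are natural numbers, so it
  suffices to let \<open>G\<close> range over the latter. The set below is finite by \<open>finite_copy_numbers\<close>.\<close>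

definition gen_turan :: "nat \<Rightarrow> 'a pair_pre_digraph \<Rightarrow> 'b pair_pre_digraph \<Rightarrow> nat" where
  "gen_turan n H F =
     Max {card (copies H G) | G :: nat pair_pre_digraph.
            oriented_graph G \<and> card (pverts G) = n \<and> copies F G = {}}"

lemma card_copies_le:
  fixes G :: "'b pair_pre_digraph"
  assumes "oriented_graph G"
  shows "card (copies H G) \<le> 2 ^ card (pverts G) * 2 ^ (card (pverts G) * card (pverts G))"
proof -
  interpret oriented_graph G by fact
  have fin: "finite (pverts G)" by (rule pair_finite_verts)
  let ?f = "\<lambda>K :: 'b pair_pre_digraph. (pverts K, parcs K)"
  let ?T = "Pow (pverts G) \<times> Pow (pverts G \<times> pverts G)"
  have "inj_on ?f (copies H G)"
    by (auto intro!: inj_onI pair_pre_digraph.equality)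
  moreover have "?f ` copies H G \<subseteq> ?T"
    using wellformed' by (auto simp: copies_def subgraph_def)
  ultimately have "card (copies H G) \<le> card ?T"
    using fin by (intro card_inj_on_le) auto
  then show ?thesis
    using fin by (simp add: card_cartesian_product card_Pow)
qed

lemma finite_copy_numbers:
  "finite {card (copies H G) | G :: nat pair_pre_digraph.
     oriented_graph G \<and> card (pverts G) = n \<and> copies F G = {}}"
  by (rule finite_subset[of _ "{..2 ^ n * 2 ^ (n * n)}"]) (auto dest: card_copies_le)

end

theory Submission
  imports Defs "HOL-Library.Ramsey"
begin

text \<open>
  The triangles of a \<open>C\<^sub>4\<close>- or \<open>C\<^sub>5\<close>-free oriented graph form a cancellative triple system, so
  for a fixed triangle \<open>S\<close> the map \<open>T \<mapsto> T - S\<close> is injective on triangles. Its values are triangles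
  disjoint from \<open>S\<close>, pairs forming the link of \<open>S\<close>, single vertices, and the empty set. A \<open>K\<^sub>4\<close> in
  the link would be properly 3-coloured by \<open>S\<close> and give two triangles that share one vertex and have
  all their cross pairs adjacent, which forces both a \<open>C\<^sub>4\<close> and a \<open>C\<^sub>5\<close>. Turan's bound \<open>(n - 3)\<^sup>2 / 3\<close>
  on the link is exactly what induction from \<open>n - 3\<close> to \<open>n\<close> needs.

  For \<open>l > 6\<close>, delete arcs lying in at most \<open>l\<close> triangles until none is left, losing
  \<open>O(n\<^sup>2)\<close> triangles. Then an arc \<open>u v\<close> can be replaced by a path \<open>u y z x v\<close> through new vertices,
  so a cycle of length \<open>k \<le> l - 3\<close> yields one of length \<open>k + 3\<close>, and the graph is free of \<open>C\<^sub>4\<close> or \<open>C\<^sub>5\<close>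
  according to \<open>l\<close> modulo 3.
\<close>

section \<open>Graphs without large cliques\<close>

definition neighbours :: "'a set set \<Rightarrow> 'a \<Rightarrow> 'a set" where
  "neighbours G v = {w. {v, w} \<in> G}"

lemma neighbours_subset: "G \<subseteq> [V]\<^bsup>2\<^esup> \<Longrightarrow> neighbours G v \<subseteq> V - {v}"
  by (auto simp: neighbours_def nsets_def)

lemma clique_insert_neighbours:
  "K \<subseteq> neighbours G v \<Longrightarrow> clique K G \<Longrightarrow> clique (insert v K) G"
  by (auto simp: clique_def neighbours_def insert_commute)

lemma clique_neighbours_card_le:
  assumes "finite V" "G \<subseteq> [V]\<^bsup>2\<^esup>" "v \<in> V" "K \<subseteq> neighbours G v" "clique K G"
    and "\<And>L. L \<subseteq> V \<Longrightarrow> clique L G \<Longrightarrow> card L \<le> Suc r"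
  shows "card K \<le> r"
proof -
  have "K \<subseteq> V - {v}"
    using neighbours_subset[OF assms(2)] assms(4) by blast
  then have K: "insert v K \<subseteq> V" "v \<notin> K" "finite K"
    using assms(1,3) by (auto intro: finite_subset)
  have "card (insert v K) \<le> Suc r"
    using K(1) clique_insert_neighbours[OF assms(4,5)] by (rule assms(6))
  with K(2,3) show ?thesis by simp
qed

lemma card_edges_le_sum_degrees:
  assumes "finite V" "G \<subseteq> [V]\<^bsup>2\<^esup>" "N \<subseteq> V"
  shows "card G \<le> card (G \<inter> Pow N) + (\<Sum>x\<in>V - N. card (neighbours G x))"
proof -
  have finite_nbs: "finite (neighbours G x)" for x
    using neighbours_subset[OF assms(2)] assms(1) by (meson finite_Diff finite_subset)
  define F where "F = (\<Union>x\<in>V - N. (\<lambda>w. {x, w}) ` neighbours G x)"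
  have "G \<subseteq> (G \<inter> Pow N) \<union> F"
  proof
    fix e assume "e \<in> G"
    then obtain x y where e: "e = {x, y}" "x \<in> V" "y \<in> V"
      using assms(2) by (metis nsets2_E subsetD)
    then have "x \<in> neighbours G y" "y \<in> neighbours G x"
      using \<open>e \<in> G\<close> by (auto simp: neighbours_def insert_commute)
    with e \<open>e \<in> G\<close> show "e \<in> (G \<inter> Pow N) \<union> F"
      unfolding F_def by (cases "e \<subseteq> N") (auto simp: insert_commute)
  qed
  then have "card G \<le> card ((G \<inter> Pow N) \<union> F)"
    using assms(1,3) finite_nbs by (intro card_mono) (auto simp: F_def intro: finite_subset)
  also have "\<dots> \<le> card (G \<inter> Pow N) + card F"
    by (rule card_Un_le)
  also have "card F \<le> (\<Sum>x\<in>V - N. card ((\<lambda>w. {x, w}) ` neighbours G x))"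
    unfolding F_def using assms(1) by (intro card_UN_le) simp
  also have "\<dots> \<le> (\<Sum>x\<in>V - N. card (neighbours G x))"
    using finite_nbs by (intro sum_mono card_image_le)
  finally show ?thesis by simp
qed

lemma max_degree_card_edges_le:
  assumes "finite V" "V \<noteq> {}" "G \<subseteq> [V]\<^bsup>2\<^esup>"
  obtains v where "v \<in> V"
    "card G \<le> card (G \<inter> Pow (neighbours G v))
       + (card V - card (neighbours G v)) * card (neighbours G v)"
proof -
  define d where "d x = card (neighbours G x)" for x
  have "Max (d ` V) \<in> d ` V"
    using assms by (intro Max_in) auto
  then obtain v where "v \<in> V" and max: "d v = Max (d ` V)" by auto
  let ?N = "neighbours G v"
  have N: "?N \<subseteq> V"
    using neighbours_subset[OF assms(3)] by blast
  have "(\<Sum>x\<in>V - ?N. d x) \<le> card (V - ?N) * d v"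
    using assms(1) max by (intro sum_bounded_above[of _ _ "d v", simplified]) simp
  also have "card (V - ?N) = card V - card ?N"
    using N assms(1) by (meson card_Diff_subset finite_subset)
  finally show thesis
    using that[OF \<open>v \<in> V\<close>] card_edges_le_sum_degrees[OF assms(1,3) N] unfolding d_def by linarith
qed

lemma turan_bound_arith:
  fixes r d m e f :: nat
  assumes "r > 0" "2 * r * e \<le> (r - 1) * d\<^sup>2" "f \<le> e + m * d"
  shows "2 * (r + 1) * f \<le> r * (d + m)\<^sup>2"
proof -
  obtain q where r: "r = q + 1"
    using assms(1) by (metis Suc_eq_plus1 gr0_implies_Suc)
  have "r * (2 * (r + 1) * f) \<le> r * (2 * (r + 1) * (e + m * d))"
    using assms(3) by (intro mult_le_mono2)
  also have "\<dots> = (r + 1) * (2 * r * e) + 2 * r * (r + 1) * (m * d)"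
    by (simp add: algebra_simps)
  also have "\<dots> \<le> (r + 1) * (q * d\<^sup>2) + 2 * r * (r + 1) * (m * d)"
    using assms(2) by (intro add_le_mono1 mult_le_mono2) (simp add: r)
  also have "\<dots> \<le> r * (r * (d + m)\<^sup>2)"
  proof -
    have "int (r * (r * (d + m)\<^sup>2)) - int ((r + 1) * (q * d\<^sup>2) + 2 * r * (r + 1) * (m * d))
        = (int r * int m - int d)\<^sup>2"
      by (simp add: r power2_eq_square algebra_simps)
    then show ?thesis
      by (metis diff_ge_0_iff_ge of_nat_le_iff zero_le_power2)
  qed
  finally show ?thesis
    using assms(1) by simp
qed

lemma no_edges_if_cliques_trivial:
  assumes "G \<subseteq> [V]\<^bsup>2\<^esup>" "\<And>K. K \<subseteq> V \<Longrightarrow> clique K G \<Longrightarrow> card K \<le> 1"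
  shows "G = {}"
proof (rule ccontr)
  assume "G \<noteq> {}"
  then obtain x y where xy: "{x, y} \<in> G" "x \<in> V" "y \<in> V" "x \<noteq> y"
    using assms(1) by (metis all_not_in_conv nsets2_E subsetD)
  then have "clique {x, y} G"
    by (auto simp: clique_def insert_commute)
  then show False
    using assms(2)[of "{x, y}"] xy by simp
qed

theorem turan_bound:
  assumes "finite V" "G \<subseteq> [V]\<^bsup>2\<^esup>" "\<And>K. K \<subseteq> V \<Longrightarrow> clique K G \<Longrightarrow> card K \<le> r"
  shows "2 * r * card G \<le> (r - 1) * (card V)\<^sup>2"
  using assms
proof (induction r arbitrary: V G)
  case (Suc r)
  consider "V = {} \<or> r = 0" | "V \<noteq> {}" "r > 0" by blast
  then show ?case
  proof cases
    case 1
    then have "G = {}"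
      using Suc.prems(2) no_edges_if_cliques_trivial[OF Suc.prems(2)] Suc.prems(3)
      by (auto simp: nsets_empty_iff)
    then show ?thesis by simp
  next
    case 2
    then obtain v where "v \<in> V" and card_G: "card G \<le> card (G \<inter> Pow (neighbours G v))
        + (card V - card (neighbours G v)) * card (neighbours G v)"
      using max_degree_card_edges_le[OF Suc.prems(1) _ Suc.prems(2)] by blast
    let ?N = "neighbours G v"
    have N: "?N \<subseteq> V" "finite ?N"
      using neighbours_subset[OF Suc.prems(2)] Suc.prems(1) finite_subset by blast+
    have "2 * r * card (G \<inter> Pow ?N) \<le> (r - 1) * (card ?N)\<^sup>2"
    proof (rule Suc.IH[OF N(2)])
      show "G \<inter> Pow ?N \<subseteq> [?N]\<^bsup>2\<^esup>"
        using Suc.prems(2) by (auto simp: nsets_def)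
      fix K assume K: "K \<subseteq> ?N" "clique K (G \<inter> Pow ?N)"
      then have "clique K G" by (auto simp: clique_def)
      then show "card K \<le> r"
        by (rule clique_neighbours_card_le[OF Suc.prems(1,2) \<open>v \<in> V\<close> K(1) _ Suc.prems(3)])
    qed
    moreover obtain m where "card V = card ?N + m"
      using card_mono[OF Suc.prems(1) N(1)] le_Suc_ex by blast
    ultimately show ?thesis
      using turan_bound_arith[of r _ "card ?N" "card G" m] 2(2) card_G by simp
  qed
qed simp

section \<open>Cancellative triple systems\<close>

definition shadow :: "'a set set \<Rightarrow> 'a set set" where
  "shadow H = {e. card e = 2 \<and> (\<exists>T\<in>H. e \<subseteq> T)}"

definition link :: "'a set set \<Rightarrow> 'a set \<Rightarrow> 'a set set" where
  "link H S = {T - S | T. T \<in> H \<and> card (T \<inter> S) = 1}"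

lemma doubleton_in_shadow: "T \<in> H \<Longrightarrow> x \<in> T \<Longrightarrow> y \<in> T \<Longrightarrow> x \<noteq> y \<Longrightarrow> {x, y} \<in> shadow H"
  by (auto simp: shadow_def)

lemma clique_shadow: "T \<in> H \<Longrightarrow> clique T (shadow H)"
  by (auto simp: clique_def doubleton_in_shadow)

lemma shadow_mono: "H \<subseteq> H' \<Longrightarrow> shadow H \<subseteq> shadow H'"
  by (auto simp: shadow_def)

lemma in_linkE:
  assumes "e \<in> link H S"
  obtains s where "s \<in> S" "insert s e \<in> H"
proof -
  obtain T where T: "T \<in> H" "e = T - S" "card (T \<inter> S) = 1"
    using assms by (auto simp: link_def)
  then obtain s where s: "T \<inter> S = {s}"
    by (meson card_1_singletonE)
  then have "insert s e = T" "s \<in> S" using T(2) by auto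
  with T(1) that show thesis by blast
qed

locale cancellative_triple_system =
  fixes H :: "'a set set"
  assumes card_3: "T \<in> H \<Longrightarrow> card T = 3"
    and cancel: "A \<in> H \<Longrightarrow> B \<in> H \<Longrightarrow> C \<in> H \<Longrightarrow> A \<union> B = A \<union> C \<Longrightarrow> B = C"
begin

lemma finite_triple: "T \<in> H \<Longrightarrow> finite T"
  using card_3 by (metis card.infinite zero_neq_numeral)

lemma inj_on_Diff_triple:
  assumes "S \<in> H"
  shows "inj_on (\<lambda>T. T - S) H"
proof (rule inj_onI)
  fix A B
  assume "A \<in> H" "B \<in> H" "A - S = B - S"
  then show "A = B"
    using cancel[OF assms] by (metis Un_Diff_cancel)
qed

lemma card_Int_add_card_Diff: "T \<in> H \<Longrightarrow> card (T \<inter> S) + card (T - S) = 3"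
  using finite_triple[of T] card_3[of T] by (metis card_Int_Diff add.commute)

lemma link_subset_nsets:
  assumes "H \<subseteq> Pow V"
  shows "link H S \<subseteq> [V - S]\<^bsup>2\<^esup>"
proof
  fix e assume "e \<in> link H S"
  then obtain T where T: "T \<in> H" "e = T - S" "card (T \<inter> S) = 1"
    by (auto simp: link_def)
  then show "e \<in> [V - S]\<^bsup>2\<^esup>"
    using assms card_Int_add_card_Diff[of T S] finite_triple[of T] by (auto simp: nsets_def)
qed

lemma card_le_remove_triple:
  assumes "finite V" "H \<subseteq> Pow V" "S \<in> H"
  shows "card H \<le> card {T \<in> H. T \<inter> S = {}} + card (link H S) + card (V - S) + 1"
proof -
  let ?H0 = "{T \<in> H. T \<inter> S = {}}"
  have "(\<lambda>T. T - S) ` H \<subseteq> ?H0 \<union> link H S \<union> [V - S]\<^bsup>1\<^esup> \<union> [V - S]\<^bsup>0\<^esup>"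
  proof (rule image_subsetI)
    fix T assume T: "T \<in> H"
    then consider "card (T \<inter> S) = 0" | "card (T \<inter> S) = 1" | "card (T - S) = 1" | "card (T - S) = 0"
      using card_Int_add_card_Diff[of T S] by linarith
    then show "T - S \<in> ?H0 \<union> link H S \<union> [V - S]\<^bsup>1\<^esup> \<union> [V - S]\<^bsup>0\<^esup>"
    proof cases
      case 1
      then have "T \<inter> S = {}" using finite_triple[OF T] by simp
      then show ?thesis using T by (simp add: Diff_triv)
    next
      case 2
      then show ?thesis using T by (auto simp: link_def)
    qed (use T assms(2) finite_triple[OF T] in \<open>auto simp: nsets_def\<close>)
  qed
  moreover have "finite ?H0" "finite (link H S)"
    using finite_subset[OF assms(2)] finite_subset[OF link_subset_nsets[OF assms(2)]] assms(1)
    by (simp_all add: finite_imp_finite_nsets)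
  ultimately have "card H \<le> card (?H0 \<union> link H S \<union> [V - S]\<^bsup>1\<^esup> \<union> [V - S]\<^bsup>0\<^esup>)"
    using assms(1)
    by (intro card_inj_on_le[OF inj_on_Diff_triple[OF assms(3)]])
      (simp_all add: finite_imp_finite_nsets)
  also have "\<dots> \<le> card ?H0 + card (link H S) + card ([V - S]\<^bsup>1\<^esup>) + card ([V - S]\<^bsup>0\<^esup>)"
    by (meson card_Un_le add_le_mono1 order_trans)
  also have "\<dots> = card ?H0 + card (link H S) + card (V - S) + 1"
    by (simp add: nsets_one card_image)
  finally show ?thesis .
qed

text \<open>The edges of a clique in the link of \<open>S\<close> are properly coloured by the elements of \<open>S\<close>.\<close>

lemma inj_on_link_colour:
  assumes "clique K (link H S)" "x \<in> K" "K \<inter> S = {}"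
    and colour: "\<And>y. y \<in> K - {x} \<Longrightarrow> insert (c y) {x, y} \<in> H \<and> c y \<in> S"
  shows "inj_on c (K - {x})"
proof (rule inj_onI, rule ccontr)
  fix y z
  assume yz: "y \<in> K - {x}" "z \<in> K - {x}" "c y = c z" "y \<noteq> z"
  then have "{y, z} \<in> link H S"
    using assms(1) by (auto simp: clique_def)
  then obtain u where "insert u {y, z} \<in> H"
    by (rule in_linkE)
  moreover have "{c y, x, y} \<in> H" "{c y, x, z} \<in> H"
    using yz colour[of y] colour[of z] by simp_all
  moreover have "{u, y, z} \<union> {c y, x, y} = {u, y, z} \<union> {c y, x, z}" by blast
  ultimately have "{c y, x, y} = {c y, x, z}"
    by (rule cancel)
  then have "z \<in> {c y, x, y}" by blast
  then show False
    using yz colour[of y] assms(3) by auto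
qed

lemma link_clique_in_shadow:
  assumes "S \<in> H" "clique K (link H S)" "K \<inter> S = {}" "card K > 3" "x \<in> K" "s \<in> S"
  shows "{s, x} \<in> shadow H"
proof -
  have "\<forall>y\<in>K - {x}. \<exists>c. insert c {x, y} \<in> H \<and> c \<in> S"
    using assms(2,5) by (metis DiffE clique_def in_linkE singletonI)
  then obtain c where c: "\<And>y. y \<in> K - {x} \<Longrightarrow> insert (c y) {x, y} \<in> H \<and> c y \<in> S"
    by metis
  have "finite K"
    using assms(4) by (intro card_ge_0_finite) simp
  then have "card S \<le> card (c ` (K - {x}))"
    using inj_on_link_colour[OF assms(2,5,3) c] assms(4,5) card_3[OF assms(1)]
    by (subst card_image) auto
  then have "c ` (K - {x}) = S"
    using c finite_triple[OF assms(1)] by (intro card_seteq) auto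
  then obtain y where "insert s {x, y} \<in> H"
    using c assms(6) by blast
  moreover have "s \<noteq> x"
    using assms by auto
  ultimately show ?thesis
    using doubleton_in_shadow by fastforce
qed

end

locale bowtie_free_triple_system = cancellative_triple_system +
  assumes no_bowtie_clique:
    "A \<in> H \<Longrightarrow> B \<in> H \<Longrightarrow> card (A \<inter> B) = 1 \<Longrightarrow> \<not> clique (A \<union> B) (shadow H)"
begin

lemma card_link_clique_le:
  assumes "S \<in> H" "K \<inter> S = {}" "clique K (link H S)"
  shows "card K \<le> 3"
proof (rule ccontr)
  assume "\<not> card K \<le> 3"
  then have K: "card K > 3" by simp
  then have "finite K" by (intro card_ge_0_finite) simp
  then obtain x y where xy: "x \<in> K" "y \<in> K" "x \<noteq> y"
    using K card_le_Suc0_iff_eq[of K] by force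
  then obtain s where s: "s \<in> S" "insert s {x, y} \<in> H"
    using assms(3) by (metis clique_def in_linkE)
  have "S \<inter> insert s {x, y} = {s}"
    using s(1) xy assms(2) by auto
  moreover have "clique (S \<union> insert s {x, y}) (shadow H)"
  proof (intro clique_Un clique_shadow assms(1) s(2) ballI impI)
    fix v w assume vw: "v \<in> S" "w \<in> insert s {x, y}" "v \<noteq> w"
    show "{v, w} \<in> shadow H"
    proof (cases "w = s")
      case True
      then show ?thesis using doubleton_in_shadow[OF assms(1)] vw s(1) by simp
    next
      case False
      then have "w \<in> K" using vw(2) xy(1,2) by auto
      then show ?thesis using link_clique_in_shadow[OF assms(1,3,2) K] vw(1) by simp
    qed
  qed
  ultimately show False
    using no_bowtie_clique[OF assms(1) s(2)] by simp
qed

lemma card_link_le: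
  assumes "finite V" "H \<subseteq> Pow V" "S \<in> H"
  shows "3 * card (link H S) \<le> (card (V - S))\<^sup>2"
proof -
  have "card K \<le> 3" if "K \<subseteq> V - S" "clique K (link H S)" for K
    using that by (intro card_link_clique_le[OF assms(3)]) auto
  then have "2 * 3 * card (link H S) \<le> (3 - 1) * (card (V - S))\<^sup>2"
    using assms(1) link_subset_nsets[OF assms(2)] by (intro turan_bound) auto
  then show ?thesis by simp
qed

lemma bowtie_free_triple_system_subset:
  assumes "H' \<subseteq> H"
  shows "bowtie_free_triple_system H'"
proof
  show "card T = 3" if "T \<in> H'" for T
    using that assms card_3 by blast
  show "B = C" if "A \<in> H'" "B \<in> H'" "C \<in> H'" "A \<union> B = A \<union> C" for A B C
    using subsetD[OF assms that(1)] subsetD[OF assms that(2)] subsetD[OF assms that(3)] that(4)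
    by (rule cancel)
  show "\<not> clique (A \<union> B) (shadow H')" if "A \<in> H'" "B \<in> H'" "card (A \<inter> B) = 1" for A B
  proof
    assume "clique (A \<union> B) (shadow H')"
    then have "clique (A \<union> B) (shadow H)"
      using shadow_mono[OF assms] unfolding clique_def by blast
    then show False
      using no_bowtie_clique that assms by blast
  qed
qed

end

definition tripartite :: "nat \<Rightarrow> nat" where
  "tripartite n = (n div 3) * ((n + 1) div 3) * ((n + 2) div 3)"

lemma tripartite_mult_3:
  "tripartite (3 * k) = k ^ 3"
  "tripartite (3 * k + 1) = k ^ 2 * (k + 1)"
  "tripartite (3 * k + 2) = k * (k + 1) ^ 2"
proof -
  have "(3 * k + 1) div 3 = k" "(3 * k + 2) div 3 = k" "(3 * k + 3) div 3 = k + 1"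
    "(3 * k + 4) div 3 = k + 1"
    by linarith+
  then show "tripartite (3 * k) = k ^ 3" "tripartite (3 * k + 1) = k ^ 2 * (k + 1)"
    "tripartite (3 * k + 2) = k * (k + 1) ^ 2"
    by (simp_all add: tripartite_def power3_eq_cube power2_eq_square algebra_simps)
qed

lemma mod_3_cases:
  fixes n :: nat
  obtains k where "n = 3 * k" | k where "n = 3 * k + 1" | k where "n = 3 * k + 2"
proof -
  have "n = 3 * (n div 3) \<or> n = 3 * (n div 3) + 1 \<or> n = 3 * (n div 3) + 2" by linarith
  with that show thesis by blast
qed

lemma tripartite_add_3: "tripartite (n + 3) = tripartite n + n\<^sup>2 div 3 + n + 1"
proof (cases n rule: mod_3_cases)
  case (1 k)
  then have "n + 3 = 3 * (k + 1)" "n\<^sup>2 div 3 = 3 * k\<^sup>2"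
    by (simp_all add: power2_eq_square)
  then show ?thesis
    by (simp only: tripartite_mult_3 1) (simp add: power3_eq_cube power2_eq_square algebra_simps)
next
  case (2 k)
  then have "n\<^sup>2 = 3 * (3 * k\<^sup>2 + 2 * k) + 1"
    by (simp add: power2_eq_square algebra_simps)
  then have "n\<^sup>2 div 3 = 3 * k\<^sup>2 + 2 * k" by (intro div_nat_eqI) simp_all
  moreover have "n + 3 = 3 * (k + 1) + 1" using 2 by simp
  ultimately show ?thesis
    by (simp only: tripartite_mult_3 2) (simp add: power2_eq_square algebra_simps)
next
  case (3 k)
  then have "n\<^sup>2 = 3 * (3 * k\<^sup>2 + 4 * k + 1) + 1"
    by (simp add: power2_eq_square algebra_simps)
  then have "n\<^sup>2 div 3 = 3 * k\<^sup>2 + 4 * k + 1" by (intro div_nat_eqI) simp_all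
  moreover have "n + 3 = 3 * (k + 1) + 2" using 3 by simp
  ultimately show ?thesis
    by (simp only: tripartite_mult_3 3) (simp add: power2_eq_square algebra_simps)
qed

theorem card_bowtie_free_triple_system_le:
  assumes "bowtie_free_triple_system H" "finite V" "H \<subseteq> Pow V"
  shows "card H \<le> tripartite (card V)"
  using assms
proof (induction "card V" arbitrary: V H rule: less_induct)
  case less
  then interpret bowtie_free_triple_system H by blast
  show ?case
  proof (cases "H = {}")
    case False
    then obtain S where S: "S \<in> H" by blast
    let ?W = "V - S" and ?H0 = "{T \<in> H. T \<inter> S = {}}"
    have "S \<subseteq> V" using S less.prems(3) by blast
    then have cardV: "card V = card ?W + 3"
      using card_3[OF S] less.prems(2) card_mono[of V S]
      by (simp add: card_Diff_subset finite_subset)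
    have "card ?H0 \<le> tripartite (card ?W)"
      using cardV less.prems(2,3) bowtie_free_triple_system_subset[of ?H0]
      by (intro less.hyps) auto
    moreover have "card (link H S) \<le> (card ?W)\<^sup>2 div 3"
      using card_link_le[OF less.prems(2,3) S] by linarith
    ultimately show ?thesis
      using card_le_remove_triple[OF less.prems(2,3) S]
      unfolding cardV tripartite_add_3 by linarith
  qed simp
qed

section \<open>Triangles and directed cycles in a relation\<close>

definition is_dicycle :: "'a rel \<Rightarrow> 'a list \<Rightarrow> bool" where
  "is_dicycle E xs \<longleftrightarrow> xs \<noteq> [] \<and> distinct xs \<and> successively (\<lambda>u v. (u, v) \<in> E) xs
     \<and> (last xs, hd xs) \<in> E"

definition dicycle_free :: "nat \<Rightarrow> 'a rel \<Rightarrow> bool" where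
  "dicycle_free l E \<longleftrightarrow> (\<forall>xs. length xs = l \<longrightarrow> \<not> is_dicycle E xs)"

abbreviation is_triangle :: "'a rel \<Rightarrow> 'a \<Rightarrow> 'a \<Rightarrow> 'a \<Rightarrow> bool" where
  "is_triangle E x y z \<equiv> (x, y) \<in> E \<and> (y, z) \<in> E \<and> (z, x) \<in> E"

definition triangles :: "'a rel \<Rightarrow> 'a set set" where
  "triangles E = {{x, y, z} | x y z. is_triangle E x y z}"

lemma is_dicycle_mono: "is_dicycle E xs \<Longrightarrow> E \<subseteq> F \<Longrightarrow> is_dicycle F xs"
  unfolding is_dicycle_def by (auto intro: successively_mono)

lemma triangles_subset_Pow: "E \<subseteq> V \<times> V \<Longrightarrow> triangles E \<subseteq> Pow V"
  unfolding triangles_def by auto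

lemma triangle_at_vertex:
  assumes "T \<in> triangles E" "v \<in> T"
  obtains x y where "T = {v, x, y}" "is_triangle E v x y"
proof -
  obtain x y z where T: "T = {x, y, z}" "is_triangle E x y z"
    using assms(1) by (auto simp: triangles_def)
  with assms(2) consider "v = x" | "v = y" | "v = z" by blast
  then show thesis
    using T that[of x y] that[of y z] that[of z x] by cases (auto simp: insert_commute)
qed

lemma triangle_at_pair:
  assumes "T \<in> triangles E" "x \<in> T" "y \<in> T" "x \<noteq> y"
  obtains z where "T = {x, y, z}" "is_triangle E x y z \<or> is_triangle E y x z"
proof -
  obtain a b where T: "T = {x, a, b}" "is_triangle E x a b"
    using triangle_at_vertex[OF assms(1,2)] .
  then consider "y = a" | "y = b" using assms(3,4) by blast
  then show thesis
    using T that[of a] that[of b] by cases (auto simp: insert_commute)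
qed

lemma card_triangle:
  assumes "asym E" "T \<in> triangles E"
  shows "card T = 3"
  using assms by (auto simp: triangles_def card_insert_if dest: asymD)

lemma adjacent_if_in_shadow_triangles:
  assumes "{x, y} \<in> shadow (triangles E)"
  shows "(x, y) \<in> E \<or> (y, x) \<in> E"
proof -
  obtain T where "T \<in> triangles E" "x \<in> T" "y \<in> T" "x \<noteq> y"
    using assms by (auto simp: shadow_def card_2_iff doubleton_eq_iff)
  then show ?thesis
    by (rule triangle_at_pair) blast
qed

lemma no_triangle_through_apexes:
  assumes "asym E" "l \<in> {4, 5}" "dicycle_free l E"
    and tri: "is_triangle E a b c" "is_triangle E a b d" "is_triangle E c d e"
  shows False
proof -
  have "distinct [b, c, d, a]" "distinct [d, e, c, a, b]"
    using tri \<open>asym E\<close> by (auto dest: asymD)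
  then have "is_dicycle E [b, c, d, a]" "is_dicycle E [d, e, c, a, b]"
    using tri by (simp_all add: is_dicycle_def)
  then have "\<not> dicycle_free 4 E" "\<not> dicycle_free 5 E"
    unfolding dicycle_free_def by fastforce+
  then show False using assms(2,3) by auto
qed

lemma no_complete_bowtie_if_C4_free:
  assumes "dicycle_free 4 E" "distinct [a, b, c, x, y]"
    and "is_triangle E a b c" "is_triangle E a x y" "(b, x) \<in> E \<or> (x, b) \<in> E"
  shows False
proof -
  have "is_dicycle E [a, b, x, y] \<or> is_dicycle E [a, x, b, c]"
    using assms by (auto simp: is_dicycle_def)
  then show False
    using assms(1) by (auto simp: dicycle_free_def)
qed

lemma no_complete_bowtie_if_C5_free:
  assumes free: "dicycle_free 5 E" and dist: "distinct [a, b, c, x, y]"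
    and tri: "is_triangle E a b c" "is_triangle E a x y"
    and adj: "(b, x) \<in> E \<or> (x, b) \<in> E" "(b, y) \<in> E \<or> (y, b) \<in> E"
      "(c, x) \<in> E \<or> (x, c) \<in> E" "(c, y) \<in> E \<or> (y, c) \<in> E"
  shows False
proof -
  have no_cycle: "\<not> is_dicycle E [p, q, r, s, t]" for p q r s t
    using free by (simp add: dicycle_free_def)
  have x_c: "(x, c) \<in> E"
    using no_cycle[of a b c x y] dist tri adj(3) by (auto simp: is_dicycle_def)
  have b_y: "(b, y) \<in> E"
    using no_cycle[of a x y b c] dist tri adj(2) by (auto simp: is_dicycle_def)
  from adj(1,4) consider "(b, x) \<in> E" "(c, y) \<in> E" | "(b, x) \<in> E" "(y, c) \<in> E"
    | "(x, b) \<in> E" "(c, y) \<in> E" | "(x, b) \<in> E" "(y, c) \<in> E"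
    by blast
  then show False
  proof cases
    case 1
    then show False using no_cycle[of a b x c y] x_c dist tri by (auto simp: is_dicycle_def)
  next
    case 2
    then show False using no_cycle[of a b x y c] dist tri by (auto simp: is_dicycle_def)
  next
    case 3
    then show False using no_cycle[of a x b c y] dist tri by (auto simp: is_dicycle_def)
  next
    case 4
    then show False using no_cycle[of a x b y c] b_y dist tri by (auto simp: is_dicycle_def)
  qed
qed

lemma equal_Un_triples:
  assumes "card S = 3" "card A = 3" "card B = 3" "S \<union> A = S \<union> B" "A \<noteq> B"
  obtains s t x y where "A = {x, y, s}" "B = {x, y, t}" "s \<in> S" "t \<in> S" "s \<noteq> t" "x \<noteq> y"
proof -
  have fin: "finite S" "finite A" "finite B"
    using assms(1-3) by (auto intro: card_ge_0_finite)
  have cards: "card (A \<inter> B) + card (A - B) = 3" "card (A \<inter> B) + card (B - A) = 3"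
    using assms(2,3) fin card_Int_Diff[of A B] card_Int_Diff[of B A] by (simp_all add: Int_commute)
  have "A - B \<noteq> {}"
    using assms(5) cards fin by (metis Diff_eq_empty_iff add_left_cancel card_eq_0_iff
        finite_Diff subset_antisym)
  then have "card (A - B) > 0" using fin by (simp add: card_gt_0_iff)
  moreover have "card (A - B) + card (B - A) = card ((A - B) \<union> (B - A))"
    using fin by (subst card_Un_disjoint) auto
  moreover have "(A - B) \<union> (B - A) \<subseteq> S" using assms(4) by blast
  then have "card ((A - B) \<union> (B - A)) \<le> 3"
    using fin card_mono[of S] assms(1) by metis
  ultimately have "card (A - B) = 1" "card (B - A) = 1" "card (A \<inter> B) = 2"
    using cards by linarith+
  then obtain s t x y where st: "A - B = {s}" "B - A = {t}" and xy: "A \<inter> B = {x, y}" "x \<noteq> y"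
    by (metis card_1_singletonE card_2_iff)
  show thesis
  proof (rule that)
    show "A = {x, y, s}" "B = {x, y, t}" "s \<in> S" "t \<in> S" "s \<noteq> t"
      using st xy(1) assms(4) by blast+
  qed (rule xy(2))
qed

lemma triangles_cancellative:
  assumes "asym E" "l \<in> {4, 5}" "dicycle_free l E"
    and "S \<in> triangles E" "A \<in> triangles E" "B \<in> triangles E" "S \<union> A = S \<union> B"
  shows "A = B"
proof (rule ccontr)
  assume "A \<noteq> B"
  have card: "card T = 3" if "T \<in> triangles E" for T
    using card_triangle[OF assms(1) that] .
  obtain s t x y where A: "A = {x, y, s}" and B: "B = {x, y, t}"
    and st: "s \<in> S" "t \<in> S" "s \<noteq> t" and "x \<noteq> y"
    by (rule equal_Un_triples[OF card card card assms(7) \<open>A \<noteq> B\<close>]) (use assms(4-6) in blast)+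
  have distinct: "s \<noteq> x" "s \<noteq> y" "t \<noteq> x" "t \<noteq> y"
    using card[OF assms(5)] card[OF assms(6)] by (auto simp: A B card_insert_if split: if_splits)
  have "is_triangle E x y s \<or> is_triangle E y x s"
    by (rule triangle_at_pair[OF assms(5), of x y]) (use \<open>x \<noteq> y\<close> distinct in \<open>auto simp: A\<close>)
  moreover have "is_triangle E x y t \<or> is_triangle E y x t"
    by (rule triangle_at_pair[OF assms(6), of x y]) (use \<open>x \<noteq> y\<close> distinct in \<open>auto simp: B\<close>)
  moreover have "(x, y) \<notin> E \<or> (y, x) \<notin> E"
    using asymD[OF \<open>asym E\<close>] by blast
  ultimately obtain a b where ab: "is_triangle E a b s" "is_triangle E a b t"
    by blast
  obtain u where "is_triangle E s t u \<or> is_triangle E t s u"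
    by (rule triangle_at_pair[OF assms(4) st])
  then show False
    using no_triangle_through_apexes[OF assms(1-3) ab, of u]
      no_triangle_through_apexes[OF assms(1-3) ab(2,1), of u] by blast
qed

lemma no_clique_bowtie_triangles:
  assumes "asym E" "l \<in> {4, 5}" "dicycle_free l E"
    and "A \<in> triangles E" "B \<in> triangles E" "card (A \<inter> B) = 1"
  shows "\<not> clique (A \<union> B) (shadow (triangles E))"
proof
  assume clique: "clique (A \<union> B) (shadow (triangles E))"
  obtain a where a: "A \<inter> B = {a}"
    using assms(6) by (rule card_1_singletonE)
  then obtain b c where A: "A = {a, b, c}" "is_triangle E a b c"
    using triangle_at_vertex[OF assms(4)] by blast
  obtain x y where B: "B = {a, x, y}" "is_triangle E a x y"
    using triangle_at_vertex[OF assms(5)] a by blast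
  have distinct: "distinct [a, b, c, x, y]"
    using a A B asymD[OF \<open>asym E\<close>] by auto
  have adj: "(u, v) \<in> E \<or> (v, u) \<in> E" if "u \<in> {b, c}" "v \<in> {x, y}" for u v
  proof (rule adjacent_if_in_shadow_triangles)
    have "u \<in> A \<union> B" "v \<in> A \<union> B" "u \<noteq> v"
      using that distinct A(1) B(1) by auto
    with clique show "{u, v} \<in> shadow (triangles E)" by (simp add: clique_def)
  qed
  from assms(2) consider "l = 4" | "l = 5" by blast
  then show False
  proof cases
    case 1
    then show False
      using no_complete_bowtie_if_C4_free[OF _ distinct A(2) B(2) adj] assms(3) by simp
  next
    case 2
    then show False
      using no_complete_bowtie_if_C5_free[OF _ distinct A(2) B(2) adj adj adj adj] assms(3) by simp
  qed
qed

theorem card_triangles_le_tripartite: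
  assumes "asym E" "l \<in> {4, 5}" "dicycle_free l E" "finite V" "E \<subseteq> V \<times> V"
  shows "card (triangles E) \<le> tripartite (card V)"
proof (rule card_bowtie_free_triple_system_le)
  show "bowtie_free_triple_system (triangles E)"
    using card_triangle[OF assms(1)] triangles_cancellative[OF assms(1-3)]
      no_clique_bowtie_triangles[OF assms(1-3)]
    by unfold_locales
qed (use assms(4) triangles_subset_Pow[OF assms(5)] in auto)

section \<open>Lengthening cycles through arcs in many triangles\<close>

definition apexes :: "'a rel \<Rightarrow> 'a \<Rightarrow> 'a \<Rightarrow> 'a set" where
  "apexes E x y = {z. (y, z) \<in> E \<and> (z, x) \<in> E}"

definition robust :: "nat \<Rightarrow> 'a rel \<Rightarrow> bool" where
  "robust k E \<longleftrightarrow> (\<forall>(x, y) \<in> E. k < card (apexes E x y))"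

lemma robust_obtain_apex:
  assumes "robust k E" "(x, y) \<in> E" "card (set zs) \<le> k"
  obtains z where "z \<notin> set zs" "(y, z) \<in> E" "(z, x) \<in> E"
proof -
  have "\<not> apexes E x y \<subseteq> set zs"
  proof
    assume "apexes E x y \<subseteq> set zs"
    then have "card (apexes E x y) \<le> card (set zs)"
      by (intro card_mono) simp_all
    with assms show False by (auto simp: robust_def)
  qed
  with that show thesis by (auto simp: apexes_def)
qed

text \<open>The closing arc \<open>(u, v)\<close> of the cycle is replaced by a path \<open>u y z x v\<close>, where \<open>z\<close>, \<open>y\<close>
  and \<open>x\<close> are new apexes of \<open>(u, v)\<close>, \<open>(z, u)\<close> and \<open>(v, z)\<close>.\<close>

lemma robust_lengthen_dicycle:
  assumes "robust k E" "is_dicycle E xs" "length xs + 2 \<le> k"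
  obtains ys where "is_dicycle E ys" "length ys = length xs + 3"
proof -
  have xs: "xs \<noteq> []" "distinct xs" "successively (\<lambda>u v. (u, v) \<in> E) xs" "(last xs, hd xs) \<in> E"
    using assms(2) by (auto simp: is_dicycle_def)
  have few: "card (set zs) \<le> k" if "length zs \<le> length xs + 2" for zs :: "'a list"
    using card_length[of zs] that assms(3) by linarith
  obtain z where z: "z \<notin> set xs" "(hd xs, z) \<in> E" "(z, last xs) \<in> E"
    by (rule robust_obtain_apex[OF assms(1) xs(4) few]) auto
  obtain y where y: "y \<notin> set (z # xs)" "(last xs, y) \<in> E" "(y, z) \<in> E"
    by (rule robust_obtain_apex[OF assms(1) z(3) few[of "z # xs"]]) simp_all
  obtain x where x: "x \<notin> set (y # z # xs)" "(z, x) \<in> E" "(x, hd xs) \<in> E"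
    by (rule robust_obtain_apex[OF assms(1) z(2) few[of "y # z # xs"]]) simp_all
  have "is_dicycle E (xs @ [y, z, x])"
    using xs x y z by (auto simp: is_dicycle_def successively_append_iff)
  then show thesis using that by force
qed

lemma robust_lengthen_dicycle_mult:
  assumes "robust k E" "is_dicycle E xs" "length xs + 3 * m \<le> k + 1"
  obtains ys where "is_dicycle E ys" "length ys = length xs + 3 * m"
  using assms(3)
proof (induction m arbitrary: thesis)
  case 0
  then show ?case using assms(2) by simp
next
  case (Suc m)
  then obtain ys where ys: "is_dicycle E ys" "length ys = length xs + 3 * m" by auto
  obtain zs where "is_dicycle E zs" "length zs = length ys + 3"
    by (rule robust_lengthen_dicycle[OF assms(1) ys(1)]) (use ys(2) Suc.prems in auto)
  then show ?case using Suc.prems(1) ys(2) by simp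
qed

lemma robust_dicycle_free:
  assumes "robust k E" "dicycle_free (l + 3 * m) E" "l + 3 * m \<le> k + 1"
  shows "dicycle_free l E"
  using assms robust_lengthen_dicycle_mult unfolding dicycle_free_def by metis

lemma triangles_remove_arc_subset:
  "triangles E \<subseteq> triangles (E - {(x, y)}) \<union> (\<lambda>z. {x, y, z}) ` apexes E x y"
proof
  fix T assume "T \<in> triangles E"
  then obtain u v w where T: "T = {u, v, w}" "is_triangle E u v w"
    by (auto simp: triangles_def)
  show "T \<in> triangles (E - {(x, y)}) \<union> (\<lambda>z. {x, y, z}) ` apexes E x y"
  proof (cases "is_triangle (E - {(x, y)}) u v w")
    case True
    then show ?thesis using T unfolding triangles_def by blast
  next
    case False
    then have "(u, v) = (x, y) \<or> (v, w) = (x, y) \<or> (w, u) = (x, y)"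
      using T by auto
    then show ?thesis using T by (auto simp: apexes_def)
  qed
qed

lemma card_triangles_remove_arc:
  assumes "finite E"
  shows "card (triangles E) \<le> card (triangles (E - {(x, y)})) + card (apexes E x y)"
proof -
  have "E \<subseteq> Field E \<times> Field E"
    by (auto intro: FieldI1 FieldI2)
  then have "finite (triangles (E - {(x, y)}))"
    using assms finite_Field by (intro finite_subset[OF triangles_subset_Pow[of _ "Field E"]]) auto
  moreover have "apexes E x y \<subseteq> Field E"
    by (auto simp: apexes_def intro: FieldI1)
  then have finite_apexes: "finite (apexes E x y)"
    using assms finite_Field finite_subset by blast
  ultimately have "card (triangles E)
      \<le> card (triangles (E - {(x, y)}) \<union> (\<lambda>z. {x, y, z}) ` apexes E x y)"
    by (intro card_mono triangles_remove_arc_subset) auto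
  also have "\<dots> \<le> card (triangles (E - {(x, y)})) + card ((\<lambda>z. {x, y, z}) ` apexes E x y)"
    by (rule card_Un_le)
  also have "\<dots> \<le> card (triangles (E - {(x, y)})) + card (apexes E x y)"
    using card_image_le[OF finite_apexes] by (intro add_left_mono)
  finally show ?thesis .
qed

lemma ex_robust_subset:
  assumes "finite E"
  shows "\<exists>F\<subseteq>E. robust k F \<and> card (triangles E) \<le> card (triangles F) + k * card (E - F)"
  using assms
proof (induction E rule: finite_psubset_induct)
  case (psubset E)
  show ?case
  proof (cases "robust k E")
    case False
    then obtain x y where xy: "(x, y) \<in> E" "card (apexes E x y) \<le> k"
      by (auto simp: robust_def not_less)
    let ?E = "E - {(x, y)}"
    obtain F where F: "F \<subseteq> ?E" "robust k F"
      "card (triangles ?E) \<le> card (triangles F) + k * card (?E - F)"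
      using psubset.IH[of ?E] xy(1) by blast
    have "E - F = insert (x, y) (?E - F)" using xy(1) F(1) by auto
    then have "card (E - F) = card (?E - F) + 1"
      using psubset.hyps by simp
    then have "card (triangles E) \<le> card (triangles F) + k * card (E - F)"
      using card_triangles_remove_arc[OF psubset.hyps, of x y] xy(2) F(3) by simp
    with F show ?thesis by blast
  qed auto
qed

theorem card_triangles_le_tripartite_plus:
  assumes "asym E" "l > 6" "\<not> 3 dvd l" "dicycle_free l E" "finite V" "E \<subseteq> V \<times> V"
  shows "card (triangles E) \<le> tripartite (card V) + l * (card V)\<^sup>2"
proof -
  have "finite E" using assms(5,6) by (meson finite_SigmaI finite_subset)
  then obtain F where F: "F \<subseteq> E" "robust l F"
    "card (triangles E) \<le> card (triangles F) + l * card (E - F)"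
    using ex_robust_subset by blast
  define r m where "r = 3 + l mod 3" and "m = l div 3 - 1"
  have "l mod 3 = 1 \<or> l mod 3 = 2" using assms(3) by presburger
  then have r: "r \<in> {4, 5}" by (auto simp: r_def)
  have l: "l = r + 3 * m"
    using assms(2) unfolding r_def m_def by presburger
  have "dicycle_free l F"
    using assms(4) is_dicycle_mono[OF _ F(1)] unfolding dicycle_free_def by blast
  then have "dicycle_free r F"
    using F(2) l by (intro robust_dicycle_free[of l F r m]) simp_all
  moreover have "asym F"
    using assms(1) F(1) by (auto intro!: asymI dest: asymD)
  ultimately have "card (triangles F) \<le> tripartite (card V)"
    using card_triangles_le_tripartite[OF _ r] assms(5,6) F(1) by blast
  moreover have "card (E - F) \<le> card (V \<times> V)"
    using assms(5,6) by (intro card_mono) auto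
  then have "l * card (E - F) \<le> l * (card V)\<^sup>2"
    by (simp add: card_cartesian_product power2_eq_square)
  ultimately show ?thesis using F(3) by linarith
qed

section \<open>Copies of directed cycles\<close>

definition map_digraph :: "('a \<Rightarrow> 'b) \<Rightarrow> 'a pair_pre_digraph \<Rightarrow> 'b pair_pre_digraph" where
  "map_digraph f H = \<lparr>pverts = f ` pverts H, parcs = map_prod f f ` parcs H\<rparr>"

lemma map_digraph_simps [simp]:
  "pverts (map_digraph f H) = f ` pverts H" "parcs (map_digraph f H) = map_prod f f ` parcs H"
  by (simp_all add: map_digraph_def)

lemma map_digraph_cong:
  assumes "pair_wf_digraph H" "\<And>v. v \<in> pverts H \<Longrightarrow> f v = g v"
  shows "map_digraph f H = map_digraph g H"
proof -
  interpret pair_wf_digraph H by fact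
  have "map_prod f f e = map_prod g g e" if "e \<in> parcs H" for e
    using that assms(2) arc_fst_in_verts arc_snd_in_verts by (simp add: map_prod_def split_beta)
  then show ?thesis
    using assms(2) by (auto simp: map_digraph_def intro!: image_cong)
qed

lemma pair_wf_digraph_map_digraph:
  assumes "pair_wf_digraph H"
  shows "pair_wf_digraph (map_digraph f H)"
  using assms by (auto simp: pair_wf_digraph_def)

lemma digraph_iso_with_proj_iff:
  assumes "pair_wf_digraph H"
  shows "digraph_iso (with_proj H) (with_proj K)
    \<longleftrightarrow> (\<exists>f. inj_on f (pverts H) \<and> K = map_digraph f H)"
proof
  assume "digraph_iso (with_proj H) (with_proj K)"
  then obtain h where iso: "pre_digraph.digraph_isomorphism (with_proj H) h"
    and K: "with_proj K = app_iso h (with_proj H)"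
    by (auto simp: digraph_iso_def)
  let ?f = "iso_verts h"
  have ends: "iso_tail h = fst" "iso_head h = snd"
    using arg_cong[OF K, of tail] arg_cong[OF K, of head] by simp_all
  have "iso_arcs h e = map_prod ?f ?f e" if "e \<in> parcs H" for e
    using iso that
    by (intro prod_eqI) (simp_all add: pre_digraph.digraph_isomorphism_def ends)
  then have "parcs K = map_prod ?f ?f ` parcs H"
    using arg_cong[OF K, of pre_digraph.arcs] by simp
  moreover have "pverts K = ?f ` pverts H"
    using arg_cong[OF K, of verts] by simp
  ultimately have "K = map_digraph ?f H"
    by (simp add: map_digraph_def)
  moreover have "inj_on ?f (pverts H)"
    using iso by (simp add: pre_digraph.digraph_isomorphism_def)
  ultimately show "\<exists>f. inj_on f (pverts H) \<and> K = map_digraph f H" by blast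
next
  assume "\<exists>f. inj_on f (pverts H) \<and> K = map_digraph f H"
  then obtain f where f: "inj_on f (pverts H)" "K = map_digraph f H" by blast
  interpret pair_wf_digraph H by fact
  define h where "h = \<lparr>iso_verts = f, iso_arcs = map_prod f f, iso_head = snd, iso_tail = fst\<rparr>"
  have "inj_on (map_prod f f) (parcs H)"
    using map_prod_inj_on[OF f(1) f(1)] by (rule inj_on_subset) (auto dest: wellformed')
  then have "digraph_isomorphism h"
    using f(1) wf_digraph_axioms by (simp add: digraph_isomorphism_def h_def)
  moreover have "with_proj K = app_iso h (with_proj H)"
    by (simp add: f(2) app_iso_def h_def with_proj_def)
  ultimately show "digraph_iso (with_proj H) (with_proj K)"
    by (auto simp: digraph_iso_def)
qed

lemma copies_eq_map_digraph:
  assumes "pair_wf_digraph H" "pair_wf_digraph G"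
  shows "copies H G = {map_digraph f H | f. inj_on f (pverts H) \<and> f ` pverts H \<subseteq> pverts G
    \<and> map_prod f f ` parcs H \<subseteq> parcs G}"
proof -
  have iso: "wf_digraph (with_proj K) \<and> digraph_iso (with_proj K) (with_proj H)
      \<longleftrightarrow> (\<exists>f. inj_on f (pverts H) \<and> K = map_digraph f H)" for K
    using digraph_iso_with_proj_iff[OF assms(1)] pair_wf_digraph_map_digraph[OF assms(1)]
      digraph_iso_swap assms(1)
    by (metis wf_digraph_wp_iff)
  have "K \<in> copies H G \<longleftrightarrow> pverts K \<subseteq> pverts G \<and> parcs K \<subseteq> parcs G
      \<and> wf_digraph (with_proj K) \<and> digraph_iso (with_proj K) (with_proj H)" for K
    using assms(2) by (auto simp: copies_def subgraph_def compatible_def wf_digraph_wp_iff)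
  then show ?thesis
    unfolding set_eq_iff mem_Collect_eq iso by (metis map_digraph_simps)
qed

lemma pverts_dicycle [simp]: "pverts (dicycle m) = {..<m}"
  and parcs_dicycle: "parcs (dicycle m) = (\<lambda>i. (i, Suc i mod m)) ` {..<m}"
  by (auto simp: dicycle_def)

lemma pair_wf_digraph_dicycle: "pair_wf_digraph (dicycle m)"
  by unfold_locales (auto simp: parcs_dicycle intro!: mod_less_divisor)

lemma is_dicycle_conv_nth:
  "is_dicycle E xs \<longleftrightarrow> xs \<noteq> [] \<and> distinct xs
     \<and> (\<forall>i<length xs. (xs ! i, xs ! (Suc i mod length xs)) \<in> E)"
proof (cases "xs = []")
  case False
  then obtain n where n: "length xs = Suc n"
    by (metis length_0_conv not0_implies_Suc)
  have "(\<forall>i<length xs. (xs ! i, xs ! (Suc i mod length xs)) \<in> E)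
      \<longleftrightarrow> (\<forall>i. Suc i < length xs \<longrightarrow> (xs ! i, xs ! Suc i) \<in> E) \<and> (xs ! n, xs ! 0) \<in> E"
    unfolding n All_less_Suc by auto
  then show ?thesis
    using False
    by (auto simp: is_dicycle_def successively_conv_nth last_conv_nth hd_conv_nth n)
qed (simp add: is_dicycle_def)

lemma copies_dicycle:
  assumes "pair_wf_digraph G" "l > 0"
  shows "copies (dicycle l) G
    = (\<lambda>xs. map_digraph ((!) xs) (dicycle l)) ` {xs. length xs = l \<and> is_dicycle (parcs G) xs}"
    (is "_ = ?g ` ?C")
proof -
  interpret pair_wf_digraph G by fact
  note copies = copies_eq_map_digraph[OF pair_wf_digraph_dicycle assms(1)]
  show ?thesis
  proof (intro equalityI subsetI)
    fix K assume "K \<in> copies (dicycle l) G"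
    then obtain f where f: "K = map_digraph f (dicycle l)" "inj_on f {..<l}"
      "map_prod f f ` parcs (dicycle l) \<subseteq> parcs G"
      unfolding copies pverts_dicycle by blast
    let ?xs = "map f [0..<l]"
    have "?xs \<in> ?C"
      using f(2,3) assms(2)
      by (auto simp: parcs_dicycle is_dicycle_conv_nth distinct_map atLeast0LessThan)
    moreover have "K = ?g ?xs"
      unfolding f(1) by (rule map_digraph_cong[OF pair_wf_digraph_dicycle]) simp
    ultimately show "K \<in> ?g ` ?C" by blast
  next
    fix K assume "K \<in> ?g ` ?C"
    then obtain xs where xs: "K = ?g xs" "length xs = l" "is_dicycle (parcs G) xs" by blast
    have arcs: "(xs ! i, xs ! (Suc i mod l)) \<in> parcs G" if "i < l" for i
      using xs(2,3) that by (simp add: is_dicycle_conv_nth)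
    then have "(!) xs ` {..<l} \<subseteq> pverts G"
      using in_arcsD1 by blast
    moreover have "inj_on ((!) xs) {..<l}"
      using xs(2,3) by (auto simp: is_dicycle_def inj_on_nth)
    ultimately show "K \<in> copies (dicycle l) G"
      unfolding copies using arcs xs(1) by (auto simp: parcs_dicycle)
  qed
qed

lemma copies_dicycle_empty_iff:
  assumes "pair_wf_digraph G" "l > 0"
  shows "copies (dicycle l) G = {} \<longleftrightarrow> dicycle_free l (parcs G)"
  by (auto simp: copies_dicycle[OF assms] dicycle_free_def)

lemma oriented_graph_iff:
  "oriented_graph G \<longleftrightarrow> finite (pverts G) \<and> parcs G \<subseteq> pverts G \<times> pverts G \<and> asym (parcs G)"
proof
  assume "oriented_graph G"
  then interpret oriented_graph G .
  show "finite (pverts G) \<and> parcs G \<subseteq> pverts G \<times> pverts G \<and> asym (parcs G)"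
    using pair_finite_verts wellformed' no_opposite_arcs by (auto intro: asymI)
next
  assume G: "finite (pverts G) \<and> parcs G \<subseteq> pverts G \<times> pverts G \<and> asym (parcs G)"
  then have "finite (parcs G)"
    using finite_subset by blast
  with G show "oriented_graph G"
    by unfold_locales (auto dest: asymD)
qed

lemma oriented_graph_imp_pair_wf_digraph: "oriented_graph G \<Longrightarrow> pair_wf_digraph G"
  by (simp add: oriented_graph_def pair_digraph_def pair_fin_digraph_def)

lemma map_digraph_nth_dicycle_3:
  "map_digraph ((!) [x, y, z]) (dicycle 3)
    = \<lparr>pverts = {x, y, z}, parcs = {(x, y), (y, z), (z, x)}\<rparr>"
proof -
  have "{..<3::nat} = {0, 1, 2}" by auto
  then show ?thesis
    by (simp add: map_digraph_def parcs_dicycle numeral_2_eq_2)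
qed

lemma card_copies_dicycle_3:
  assumes "oriented_graph G"
  shows "card (copies (dicycle 3) G) = card (triangles (parcs G))"
proof -
  have asym: "asym (parcs G)"
    using assms by (simp add: oriented_graph_iff)
  have length_3: "length xs = 3 \<longleftrightarrow> (\<exists>x y z. xs = [x, y, z])" for xs :: "'a list"
    by (auto simp: numeral_3_eq_3 length_Suc_conv)
  have copies: "copies (dicycle 3) G = {\<lparr>pverts = {x, y, z}, parcs = {(x, y), (y, z), (z, x)}\<rparr>
      | x y z. is_triangle (parcs G) x y z}"
  proof -
    have dicycle_3: "is_dicycle (parcs G) [x, y, z] \<longleftrightarrow> is_triangle (parcs G) x y z" for x y z
      using asymD[OF asym] by (auto simp: is_dicycle_def)
    have "copies (dicycle 3) G = {map_digraph ((!) [x, y, z]) (dicycle 3)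
        | x y z. is_dicycle (parcs G) [x, y, z]}"
      unfolding copies_dicycle[OF oriented_graph_imp_pair_wf_digraph[OF assms] zero_less_numeral]
        length_3 by blast
    then show ?thesis
      unfolding map_digraph_nth_dicycle_3 dicycle_3 .
  qed
  have "(x, x) \<notin> parcs G" for x
    using asymD[OF asym, of x x] by blast
  then have "parcs K = parcs G \<inter> pverts K \<times> pverts K" if "K \<in> copies (dicycle 3) G" for K
    using that asymD[OF asym] unfolding copies by auto
  then have "inj_on pverts (copies (dicycle 3) G)"
    by (intro inj_onI pair_pre_digraph.equality) auto
  moreover have "pverts ` copies (dicycle 3) G = triangles (parcs G)"
    unfolding copies triangles_def by force
  ultimately show ?thesis by (metis card_image)
qed

section \<open>The balanced blow-up of the directed triangle\<close>

definition blowup_arcs :: "nat \<Rightarrow> nat rel" where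
  "blowup_arcs n = {(i, j). i < n \<and> j < n \<and> j mod 3 = Suc i mod 3}"

lemma blowup_arcs_subset: "blowup_arcs n \<subseteq> {..<n} \<times> {..<n}"
  by (auto simp: blowup_arcs_def)

lemma asym_blowup_arcs: "asym (blowup_arcs n)"
proof
  show "(j, i) \<notin> blowup_arcs n" if "(i, j) \<in> blowup_arcs n" for i j
    using that by (auto simp: blowup_arcs_def mod_Suc split: if_splits)
qed

lemma dvd_length_dicycle:
  assumes "is_dicycle E xs" and colour: "\<And>u v. (u, v) \<in> E \<Longrightarrow> c v mod m = Suc (c u) mod m"
  shows "m dvd length xs"
proof -
  let ?l = "length xs"
  have step: "c (xs ! (Suc i mod ?l)) mod m = Suc (c (xs ! i)) mod m" if "i < ?l" for i
    using assms(1) that by (intro colour) (simp add: is_dicycle_conv_nth)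
  have "xs \<noteq> []" using assms(1) by (simp add: is_dicycle_def)
  have "c (xs ! (i mod ?l)) mod m = (c (xs ! 0) + i) mod m" if "i \<le> ?l" for i
    using that
  proof (induction i)
    case (Suc i)
    have "c (xs ! (Suc i mod ?l)) mod m = Suc (c (xs ! i) mod m) mod m"
      using step[of i] Suc.prems by (simp add: mod_Suc_eq)
    also have "c (xs ! i) mod m = (c (xs ! 0) + i) mod m"
      using Suc by simp
    finally show ?case by (simp add: mod_Suc_eq)
  qed simp
  from this[of ?l] have "c (xs ! 0) mod m = (c (xs ! 0) + ?l) mod m" by simp
  then show ?thesis
    by (metis add_diff_cancel_left' dvd_refl le_add1 mod_eq_dvd_iff_nat)
qed

lemma dicycle_free_blowup_arcs:
  assumes "\<not> 3 dvd l"
  shows "dicycle_free l (blowup_arcs n)"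
  using assms dvd_length_dicycle[of "blowup_arcs n" _ id 3]
  by (auto simp: dicycle_free_def blowup_arcs_def)

lemma card_residue_class:
  fixes m n r :: nat
  assumes "r < m"
  shows "card {i. i < n \<and> i mod m = r} = (n + (m - 1 - r)) div m"
proof -
  have less_iff: "r + m * k < n \<longleftrightarrow> k < (n + (m - 1 - r)) div m" for k
  proof -
    have "k < (n + (m - 1 - r)) div m \<longleftrightarrow> Suc k * m \<le> n + (m - 1 - r)"
      using assms by (simp add: less_eq_div_iff_mult_less_eq flip: Suc_le_eq)
    also have "\<dots> \<longleftrightarrow> r + m * k < n"
      using assms by (auto simp: algebra_simps)
    finally show ?thesis by simp
  qed
  have "{i. i < n \<and> i mod m = r} = (\<lambda>k. r + m * k) ` {..<(n + (m - 1 - r)) div m}"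
  proof (intro equalityI subsetI)
    fix i assume "i \<in> {i. i < n \<and> i mod m = r}"
    then have "i < n" "i = r + m * (i div m)"
      using mod_mult_div_eq[of i m] by auto
    then show "i \<in> (\<lambda>k. r + m * k) ` {..<(n + (m - 1 - r)) div m}"
      using less_iff[of "i div m"] by auto
  next
    fix i assume "i \<in> (\<lambda>k. r + m * k) ` {..<(n + (m - 1 - r)) div m}"
    then obtain k where "i = r + m * k" "k < (n + (m - 1 - r)) div m" by blast
    then show "i \<in> {i. i < n \<and> i mod m = r}"
      using less_iff[of k] assms by simp
  qed
  moreover have "inj (\<lambda>k. r + m * k)"
    using assms by (auto simp: inj_def)
  ultimately show ?thesis
    by (simp add: card_image inj_on_subset)
qed

lemma tripartite_le_card_triangles_blowup_arcs:
  "tripartite n \<le> card (triangles (blowup_arcs n))"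
proof -
  define C where "C r = {i. i < n \<and> i mod 3 = r}" for r :: nat
  let ?f = "\<lambda>(x, y, z). {x, y, z}"
  have "inj_on ?f (C 0 \<times> C 1 \<times> C 2)"
  proof (rule inj_onI, clarsimp simp del: One_nat_def)
    fix x y z x' y' z'
    assume C: "x \<in> C 0" "y \<in> C 1" "z \<in> C 2" "x' \<in> C 0" "y' \<in> C 1" "z' \<in> C 2"
      and eq: "{x, y, z} = {x', y', z'}"
    have "x \<in> {x', y', z'}" "y \<in> {x', y', z'}" "z \<in> {x', y', z'}"
      using eq by blast+
    with C show "x = x' \<and> y = y' \<and> z = z'"
      by (auto simp: C_def)
  qed
  moreover have "?f ` (C 0 \<times> C 1 \<times> C 2) \<subseteq> triangles (blowup_arcs n)"
  proof (clarsimp simp del: One_nat_def)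
    fix x y z assume "x \<in> C 0" "y \<in> C 1" "z \<in> C 2"
    then have "is_triangle (blowup_arcs n) x y z"
      by (simp add: C_def blowup_arcs_def mod_Suc)
    then show "{x, y, z} \<in> triangles (blowup_arcs n)"
      unfolding triangles_def by blast
  qed
  moreover have "finite (triangles (blowup_arcs n))"
    using finite_subset[OF triangles_subset_Pow[OF blowup_arcs_subset]] by simp
  ultimately have "card (C 0 \<times> C 1 \<times> C 2) \<le> card (triangles (blowup_arcs n))"
    by (rule card_inj_on_le)
  moreover have "card (C 0 \<times> C 1 \<times> C 2) = tripartite n"
    by (simp add: card_cartesian_product C_def card_residue_class tripartite_def mult_ac)
  ultimately show ?thesis by simp
qed

section \<open>The extremal numbers\<close>

lemma gen_turan_ge:
  fixes G :: "nat pair_pre_digraph"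
  assumes "oriented_graph G" "copies F G = {}"
  shows "card (copies H G) \<le> gen_turan (card (pverts G)) H F"
  unfolding gen_turan_def using assms by (intro Max_ge finite_copy_numbers) blast

lemma gen_turan_le:
  assumes "oriented_graph (G0 :: nat pair_pre_digraph)" "card (pverts G0) = n" "copies F G0 = {}"
    and "\<And>G :: nat pair_pre_digraph. oriented_graph G \<Longrightarrow> card (pverts G) = n \<Longrightarrow>
      copies F G = {} \<Longrightarrow> card (copies H G) \<le> m"
  shows "gen_turan n H F \<le> m"
  unfolding gen_turan_def using assms
  by (intro Max.boundedI finite_copy_numbers) blast+

lemma extremal_blowup:
  fixes n l :: nat
  assumes "\<not> 3 dvd l"
  defines "G \<equiv> \<lparr>pverts = {..<n}, parcs = blowup_arcs n\<rparr>"
  shows "oriented_graph G" "card (pverts G) = n" "copies (dicycle l) G = {}"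
    "tripartite n \<le> card (copies (dicycle 3) G)"
proof -
  show G: "oriented_graph G"
    using blowup_arcs_subset asym_blowup_arcs by (simp add: oriented_graph_iff G_def)
  show "card (pverts G) = n" by (simp add: G_def)
  have "l > 0" using assms(1) by (cases l) auto
  then show "copies (dicycle l) G = {}"
    using dicycle_free_blowup_arcs[OF assms(1)]
      copies_dicycle_empty_iff[OF oriented_graph_imp_pair_wf_digraph[OF G]]
    by (simp add: G_def)
  show "tripartite n \<le> card (copies (dicycle 3) G)"
    using tripartite_le_card_triangles_blowup_arcs card_copies_dicycle_3[OF G] by (simp add: G_def)
qed

lemma tripartite_le_gen_turan:
  assumes "\<not> 3 dvd l"
  shows "tripartite n \<le> gen_turan n (dicycle 3) (dicycle l)"
  using extremal_blowup[OF assms, of n] gen_turan_ge le_trans by metis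

lemma gen_turan_dicycle_le:
  assumes "\<not> 3 dvd l"
    and "\<And>(V :: nat set) E. asym E \<Longrightarrow> dicycle_free l E \<Longrightarrow> finite V \<Longrightarrow> E \<subseteq> V \<times> V \<Longrightarrow>
      card (triangles E) \<le> b (card V)"
  shows "gen_turan n (dicycle 3) (dicycle l) \<le> b n"
proof (rule gen_turan_le[OF extremal_blowup(1,2,3)[OF assms(1)]])
  fix G :: "nat pair_pre_digraph"
  assume G: "oriented_graph G" "card (pverts G) = n" "copies (dicycle l) G = {}"
  have "l > 0" using assms(1) by (cases l) auto
  then have "dicycle_free l (parcs G)"
    using copies_dicycle_empty_iff oriented_graph_imp_pair_wf_digraph G(1,3) by blast
  then show "card (copies (dicycle 3) G) \<le> b n"
    using assms(2) G(1) by (simp add: card_copies_dicycle_3 oriented_graph_iff flip: G(2))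
qed

lemma gen_turan_dicycle_4_5:
  assumes "l \<in> {4, 5}"
  shows "gen_turan n (dicycle 3) (dicycle l) = tripartite n"
proof (rule antisym)
  have l: "\<not> 3 dvd l" using assms by auto
  then show "tripartite n \<le> gen_turan n (dicycle 3) (dicycle l)"
    by (rule tripartite_le_gen_turan)
  show "gen_turan n (dicycle 3) (dicycle l) \<le> tripartite n"
    using card_triangles_le_tripartite[OF _ assms] by (intro gen_turan_dicycle_le[OF l])
qed

lemma ceiling_of_int_divide_3: "\<lceil>real_of_int a / 3\<rceil> = (a + 2) div 3"
  by linarith

lemma tripartite_eq_ceilings:
  "int (tripartite n) = \<lceil>real n / 3\<rceil> * \<lceil>(real n - 1) / 3\<rceil> * \<lceil>(real n - 2) / 3\<rceil>"
proof -
  have "\<lceil>real n / 3\<rceil> = (int n + 2) div 3" "\<lceil>(real n - 1) / 3\<rceil> = (int n + 1) div 3"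
    "\<lceil>(real n - 2) / 3\<rceil> = int n div 3"
    using ceiling_of_int_divide_3[of "int n"] ceiling_of_int_divide_3[of "int n - 1"]
      ceiling_of_int_divide_3[of "int n - 2"] by simp_all
  then show ?thesis
    by (simp add: tripartite_def zdiv_int ac_simps)
qed

lemma tripartite_approx: "\<bar>real (tripartite n) - real n ^ 3 / 27\<bar> \<le> real n"
proof (cases n rule: mod_3_cases)
  case (1 k)
  have "real (tripartite n) = real n ^ 3 / 27"
    unfolding 1 tripartite_mult_3 by (simp add: power_mult_distrib)
  then show ?thesis by simp
next
  case (2 k)
  have "real (tripartite n) = real n ^ 3 / 27 - (9 * real k + 1) / 27"
    unfolding 2 tripartite_mult_3 by (simp add: power3_eq_cube power2_eq_square field_simps)
  then show ?thesis using 2 by simp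
next
  case (3 k)
  have "real (tripartite n) = real n ^ 3 / 27 - (9 * real k + 8) / 27"
    unfolding 3 tripartite_mult_3 by (simp add: power3_eq_cube power2_eq_square field_simps)
  then show ?thesis using 3 by simp
qed

lemma gen_turan_dicycle_approx:
  assumes "l > 6" "\<not> 3 dvd l"
  shows "\<bar>real (gen_turan n (dicycle 3) (dicycle l)) - real n ^ 3 / 27\<bar> \<le> (real l + 1) * (real n)\<^sup>2"
proof -
  have "gen_turan n (dicycle 3) (dicycle l) \<le> tripartite n + l * n\<^sup>2"
    using assms card_triangles_le_tripartite_plus by (intro gen_turan_dicycle_le) blast+
  then have "real (gen_turan n (dicycle 3) (dicycle l)) \<le> real (tripartite n) + real l * (real n)\<^sup>2"
    by (metis of_nat_add of_nat_le_iff of_nat_mult of_nat_power)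
  moreover have "real (tripartite n) \<le> real (gen_turan n (dicycle 3) (dicycle l))"
    using tripartite_le_gen_turan[OF assms(2)] by simp
  moreover have "0 \<le> real l * (real n)\<^sup>2" by simp
  moreover have "real n \<le> (real n)\<^sup>2"
    by (cases n) (simp_all add: power2_eq_square)
  ultimately show ?thesis
    using tripartite_approx[of n] unfolding distrib_right mult_1 by linarith
qed

theorem theorem3p10:
  shows "(\<forall>l \<in> {4, 5}. \<forall>n :: nat. n > 0 \<longrightarrow>
            int (gen_turan n (dicycle 3) (dicycle l)) =
              \<lceil>real n / 3\<rceil> * \<lceil>(real n - 1) / 3\<rceil> * \<lceil>(real n - 2) / 3\<rceil>) \<and>
         (\<forall>l :: nat. l > 6 \<and> \<not> 3 dvd l \<longrightarrow>
            (\<lambda>n :: nat. real (gen_turan n (dicycle 3) (dicycle l)) - real n ^ 3 / 27)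
              \<in> O(\<lambda>n. real n ^ 2))"
proof (intro conjI ballI allI impI)
  fix l n :: nat
  assume "l \<in> {4, 5}"
  then show "int (gen_turan n (dicycle 3) (dicycle l)) =
      \<lceil>real n / 3\<rceil> * \<lceil>(real n - 1) / 3\<rceil> * \<lceil>(real n - 2) / 3\<rceil>"
    by (simp only: gen_turan_dicycle_4_5 tripartite_eq_ceilings)
next
  fix l :: nat
  assume "l > 6 \<and> \<not> 3 dvd l"
  then show "(\<lambda>n :: nat. real (gen_turan n (dicycle 3) (dicycle l)) - real n ^ 3 / 27)
      \<in> O(\<lambda>n. real n ^ 2)"
    using gen_turan_dicycle_approx by (intro bigoI[of _ "real l + 1"]) simp
qed

end
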